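(* Let $L$ be a levellised $n$-lattice with $\mathrm{dep}_L(n-1)=k$, let $m$ be a positive integer, and let $A_i\subseteq L\setminus\{0\}$ for $i=n,\ldots,n+m-1$. The following are equivalent: (A) $\widetilde{L}=L_{A_n,\ldots,A_{n+m-1}}$ is a levellised $(n+m)$-lattice, $\mathrm{dep}_{\widetilde{L}}(a)=\mathrm{dep}_L(a)\le k$ for $1\le a<n$, and $\mathrm{dep}_{\widetilde{L}}(n)=\cdots=\mathrm{dep}_{\widetilde{L}}(n+m-1)=k+1$; (B) (i) $A_i\cap\mathrm{lev}_k(L)\neq\emptyset$ for $n\le i<n+m$; (ii) $A_i$ is a lattice-antichain for $L$ for $n\le i<n+m$; and (iii) whenever $n\le i<j<n+m$ and $a,b\in(\uparrow_L A_i)\cap(\uparrow_L A_j)$, one has $a\wedge_L b\neq 0$.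
   Context: An $n$-poset ($n\ge2$) is a finite poset whose $n$ elements are labelled $0,1,\ldots,n-1$, where $0$ is the least element and $1$ is the greatest element; an $n$-lattice is an $n$-poset that is a lattice, with meet $\wedge_L$. For $A\subseteq L$, $\uparrow_L A=\{x\in L: a\preceq_L x \text{ for some } a\in A\}$. The depth $\mathrm{dep}_L(a)$ is the integer $p$ such that $p+1$ is the maximum number of elements of a chain in $L$ with least element $a$ and greatest element $1$. $\mathrm{lev}_k(L)=\{a:\mathrm{dep}_L(a)=k\}$. $L$ is levellised if $\mathrm{dep}_L(i)\le\mathrm{dep}_L(j)$ whenever $0<i\le j<n$. A lattice-antichain for an $n$-lattice $L$ is a non-empty antichain $A\subseteq L\setminus\{0\}$ such that $a\wedge_L b\in\{0\}\cup\uparrow_L A$ for all $a,b\in\uparrow_L A$. For an $n$-poset $L$ and $A\subseteq L\setminus\{0\}$, $L_A$ is the $(n+1)$-poset on $\{0,\ldots,n\}$ whose order is the reflexive-transitive closure of $\preceq_L$ together with $0\preceq n$ and $n\preceq a$ for all $a\in A$ (so $n$ is a new atom, covered exactly by $A$ when $A$ is an antichain). $L_{A_n,\ldots,A_{n+m-1}}=(\cdots((L_{A_n})_{A_{n+1}})\cdots)_{A_{n+m-1}}$.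
   Formalization: The formal theorem additionally assumes that every A_i is an antichain of L; without this (A) does not imply (B)(ii), e.g. for L the chain 0<2<1, m=1, A_3={1,2}. *)

theory Defs
  imports "HOL-Algebra.Lattice"
begin

definition n_poset :: "nat \<Rightarrow> nat gorder \<Rightarrow> bool" where
  "n_poset n L \<longleftrightarrow> 2 \<le> n \<and> partial_order L \<and> carrier L = {0..<n} \<and>
     least L 0 (carrier L) \<and> greatest L 1 (carrier L)"

definition n_lattice :: "nat \<Rightarrow> nat gorder \<Rightarrow> bool" where
  "n_lattice n L \<longleftrightarrow> n_poset n L \<and> lattice L"

definition up :: "nat gorder \<Rightarrow> nat set \<Rightarrow> nat set" where
  "up L A = {x \<in> carrier L. \<exists>a\<in>A. a \<sqsubseteq>\<^bsub>L\<^esub> x}"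

definition chains_to_top :: "nat gorder \<Rightarrow> nat \<Rightarrow> nat set set" where
  "chains_to_top L a =
     {C. C \<subseteq> carrier L \<and> Complete_Partial_Order.chain (le L) C \<and> least L a C \<and> greatest L 1 C}"

(* The subtraction on nat does not truncate when L is an n-poset and a an element of L:
   the set of chains is then finite and non-empty, and its members are non-empty. *)
definition dep :: "nat gorder \<Rightarrow> nat \<Rightarrow> nat" where
  "dep L a = Max (card ` chains_to_top L a) - 1"

definition lev :: "nat \<Rightarrow> nat gorder \<Rightarrow> nat set" where
  "lev k L = {a \<in> carrier L. dep L a = k}"

definition levellised :: "nat \<Rightarrow> nat gorder \<Rightarrow> bool" where
  "levellised n L \<longleftrightarrow> (\<forall>i j. 0 < i \<and> i \<le> j \<and> j < n \<longrightarrow> dep L i \<le> dep L j)"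

definition antichain :: "nat gorder \<Rightarrow> nat set \<Rightarrow> bool" where
  "antichain L A \<longleftrightarrow> A \<subseteq> carrier L \<and> (\<forall>a\<in>A. \<forall>b\<in>A. a \<sqsubseteq>\<^bsub>L\<^esub> b \<longrightarrow> a = b)"

definition lattice_antichain :: "nat gorder \<Rightarrow> nat set \<Rightarrow> bool" where
  "lattice_antichain L A \<longleftrightarrow> A \<noteq> {} \<and> A \<subseteq> carrier L - {0} \<and> antichain L A \<and>
     (\<forall>a \<in> up L A. \<forall>b \<in> up L A. a \<sqinter>\<^bsub>L\<^esub> b \<in> {0} \<union> up L A)"

(* L_A for an n-poset L. The order of L is restricted to its carrier before closing, because
   a gorder leaves le unspecified outside the carrier, in particular at the new element n.
   The closure depends only on the set of minimal elements of A; A is the set of upper covers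
   of n when A is an antichain, but not in general. *)
definition extend :: "nat \<Rightarrow> nat gorder \<Rightarrow> nat set \<Rightarrow> nat gorder" where
  "extend n L A =
     \<lparr> carrier = {0..n},
       eq = (=),
       le = (\<lambda>x y. (x \<in> carrier L \<and> y \<in> carrier L \<and> x \<sqsubseteq>\<^bsub>L\<^esub> y)
                   \<or> (x = 0 \<and> y = n)
                   \<or> (x = n \<and> y \<in> A))\<^sup>*\<^sup>* \<rparr>"

(* The iterated extension by A n, ..., A (n + m - 1), in this order. *)
primrec extend_seq :: "nat \<Rightarrow> nat gorder \<Rightarrow> (nat \<Rightarrow> nat set) \<Rightarrow> nat \<Rightarrow> nat gorder" where
  "extend_seq n L A 0 = L"
| "extend_seq n L A (Suc m) = extend (n + m) (extend_seq n L A m) (A (n + m))"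

end

theory Submission
  imports Defs
begin

text \<open>
  Every \<open>A i\<close> consists of old elements, so the new elements are pairwise incomparable atoms and
  the order of the iterated extension can be written down explicitly. In particular, the up-set of
  a nonzero old element is unchanged, and so is its depth, while the depth of the new atom \<open>i\<close>
  exceeds by one the largest depth of an element of \<open>A i\<close>. Two elements \<open>a, b\<close> above a new atom \<open>i\<close>
  can only have \<open>a \<sqinter>\<^bsub>L\<^esub> b\<close> as their meet if this is \<open>0\<close> or lies above \<open>i\<close>; if it is \<open>0\<close>, then
  \<open>i\<close> itself has to be the meet, which excludes a second new atom below \<open>a\<close> and \<open>b\<close>.
\<close>

section \<open>Finite posets with a greatest element\<close>

lemma (in partial_order) finite_chain_has_least:
  assumes "finite C" "C \<noteq> {}" "C \<subseteq> carrier L" "Complete_Partial_Order.chain (\<sqsubseteq>) C"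
  shows "\<exists>b. least L b C"
  using assms
proof (induction C rule: finite_ne_induct)
  case (singleton x)
  then show ?case by (auto simp: least_def)
next
  case (insert x C)
  from insert.prems have "Complete_Partial_Order.chain (\<sqsubseteq>) C"
    by (auto simp: Complete_Partial_Order.chain_def)
  with insert obtain b where b: "least L b C" by auto
  have bC: "b \<in> C" "b \<in> carrier L" using b by (auto simp: least_def)
  consider "x \<sqsubseteq> b" | "b \<sqsubseteq> x"
    using insert.prems bC by (auto simp: Complete_Partial_Order.chain_def)
  then show ?case
  proof cases
    case 1
    have "least L x (insert x C)"
      using insert.prems 1 b bC unfolding least_def by (auto intro: le_trans[of x b])
    then show ?thesis ..
  next
    case 2
    then have "least L b (insert x C)"
      using insert.prems b unfolding least_def by auto
    then show ?thesis ..
  qed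
qed

text \<open>The join of \<open>x\<close> and \<open>y\<close> is the meet of all their upper bounds.
  That set is finite, and it is non-empty because it contains \<open>t\<close>. Only binary meets
  then have to be constructed in the extension.\<close>

lemma (in lower_semilattice) finite_top_imp_lattice:
  assumes "finite (carrier L)" and top: "greatest L t (carrier L)"
  shows "lattice L"
proof
  fix x y
  assume xy: "x \<in> carrier L" "y \<in> carrier L"
  let ?U = "Upper L {x, y}"
  have U: "finite ?U" "?U \<subseteq> carrier L" "?U \<noteq> {}"
    using assms xy by (auto simp: Upper_def greatest_def)
  then have g: "greatest L (\<Sqinter>?U) (Lower L ?U)"
    by (rule finite_inf_greatest)
  have "least L (\<Sqinter>?U) ?U"
  proof (rule least_UpperI)
    fix u assume "u \<in> {x, y}"
    then have "u \<in> Lower L ?U"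
      using xy by (auto intro!: Lower_memI simp: Upper_def)
    then show "u \<sqsubseteq> \<Sqinter>?U" using g by (simp add: greatest_def)
  next
    fix u assume "u \<in> ?U"
    then show "\<Sqinter>?U \<sqsubseteq> u" using g U by (blast dest: greatest_Lower_below)
  qed (use xy g in auto)
  then show "\<exists>s. least L s ?U" ..
qed

section \<open>Depth as the length of a longest chain up to the top\<close>

locale finite_order_top = partial_order P for P :: "nat gorder" (structure) +
  assumes fin: "finite (carrier P)"
    and top: "greatest P 1 (carrier P)"
begin

lemma chains_to_topE:
  assumes "C \<in> chains_to_top P a"
  shows "C \<subseteq> carrier P" "finite C" "Complete_Partial_Order.chain (\<sqsubseteq>) C"
    "a \<in> C" "1 \<in> C" "\<And>x. x \<in> C \<Longrightarrow> a \<sqsubseteq> x"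
  using assms finite_subset[OF _ fin] by (auto simp: chains_to_top_def least_def greatest_def)

lemma card_chain_le_dep:
  assumes "C \<in> chains_to_top P a"
  shows "card C \<le> Suc (dep P a)"
proof -
  have "finite (chains_to_top P a)"
    using fin by (auto simp: chains_to_top_def intro: finite_subset[of _ "Pow (carrier P)"])
  with assms have "card C \<le> Max (card ` chains_to_top P a)" by simp
  then show ?thesis by (simp add: dep_def)
qed

lemma obtain_maximum_chain:
  assumes "a \<in> carrier P"
  obtains C where "C \<in> chains_to_top P a" "card C = Suc (dep P a)"
proof -
  have "finite (chains_to_top P a)"
    using fin by (auto simp: chains_to_top_def intro: finite_subset[of _ "Pow (carrier P)"])
  \<comment> \<open>This chain (a singleton if \<open>a = 1\<close>) shows that the maximum is taken
    over a non-empty set and hence attained.\<close>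
  moreover have "{a, 1} \<in> chains_to_top P a"
    using assms top
    by (auto simp: chains_to_top_def Complete_Partial_Order.chain_def least_def greatest_def)
  ultimately have "Max (card ` chains_to_top P a) \<in> card ` chains_to_top P a"
    by (intro Max_in) auto
  then obtain C where C: "C \<in> chains_to_top P a" "card C = Max (card ` chains_to_top P a)"
    by auto
  \<comment> \<open>Positivity makes the natural-number subtraction in \<open>dep\<close>
    exact.\<close>
  have "card C > 0" using chains_to_topE[OF C(1)] by (auto simp: card_gt_0_iff)
  with C that show ?thesis by (simp add: dep_def)
qed

lemma dep_less:
  assumes "a \<in> carrier P" "b \<in> carrier P" "a \<sqsubseteq> b" "a \<noteq> b"
  shows "dep P b < dep P a"
proof -
  obtain C where C: "C \<in> chains_to_top P b" "card C = Suc (dep P b)"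
    using obtain_maximum_chain assms(2) by blast
  note CE = chains_to_topE[OF C(1)]
  have above: "a \<sqsubseteq> x" if "x \<in> C" for x
    using that CE assms le_trans[of a b x] by blast
  have "a \<notin> C" using CE assms by blast
  have "insert a C \<in> chains_to_top P a"
    using CE assms above top
    by (auto simp: chains_to_top_def Complete_Partial_Order.chain_def least_def greatest_def)
  from card_chain_le_dep[OF this] show ?thesis
    using \<open>a \<notin> C\<close> CE(2) C(2) by simp
qed

lemma dep_mono:
  assumes "a \<in> carrier P" "b \<in> carrier P" "a \<sqsubseteq> b"
  shows "dep P b \<le> dep P a"
  using dep_less[OF assms] by (cases "a = b") auto

text \<open>Remove \<open>a\<close> from a longest chain starting at \<open>a\<close>, and let
  \<open>b\<close> be the least element of the rest. The rest is a chain from \<open>b\<close> to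
  the top, so \<open>dep P a\<close> is at most \<open>dep P b + 1\<close>; \<open>dep_less\<close>
  gives the other bound.\<close>

lemma dep_step:
  assumes "a \<in> carrier P" "a \<noteq> 1"
  obtains b where "b \<in> carrier P" "a \<sqsubseteq> b" "a \<noteq> b" "dep P a = Suc (dep P b)"
proof -
  obtain C where C: "C \<in> chains_to_top P a" "card C = Suc (dep P a)"
    using obtain_maximum_chain assms(1) by blast
  note CE = chains_to_topE[OF C(1)]
  have "\<exists>b. least P b (C - {a})"
    using CE assms by (intro finite_chain_has_least) (auto simp: Complete_Partial_Order.chain_def)
  then obtain b where b: "least P b (C - {a})" ..
  then have bC: "b \<in> C" "b \<noteq> a" by (auto simp: least_def)
  have "C - {a} \<in> chains_to_top P b"
    using CE b assms top
    by (auto simp: chains_to_top_def Complete_Partial_Order.chain_def greatest_def)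
  from card_chain_le_dep[OF this] have "dep P a \<le> Suc (dep P b)"
    using C CE by simp
  moreover have "dep P b < dep P a"
    using bC CE assms by (intro dep_less) auto
  ultimately show ?thesis
    using that[of b] bC CE by auto
qed

end

section \<open>The iterated extension\<close>

locale lattice_extension =
  fixes L :: "nat gorder" and n m :: nat and A :: "nat \<Rightarrow> nat set"
  assumes L_lattice: "n_lattice n L"
    and A_subset: "\<And>i. n \<le> i \<Longrightarrow> i < n + m \<Longrightarrow> A i \<subseteq> carrier L - {0}"
begin

sublocale L: lattice L
  using L_lattice by (simp add: n_lattice_def)

lemma carrier_L: "carrier L = {0..<n}" and n_ge_2: "2 \<le> n"
  using L_lattice by (simp_all add: n_lattice_def n_poset_def)

lemma zero_le: "x < n \<Longrightarrow> 0 \<sqsubseteq>\<^bsub>L\<^esub> x" and le_one: "x < n \<Longrightarrow> x \<sqsubseteq>\<^bsub>L\<^esub> 1"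
  using L_lattice by (auto simp: n_lattice_def n_poset_def least_def greatest_def)

lemma le_zero: "x < n \<Longrightarrow> x \<sqsubseteq>\<^bsub>L\<^esub> 0 \<Longrightarrow> x = 0"
  using zero_le n_ge_2 by (auto simp: carrier_L intro: L.le_antisym)

sublocale L: finite_order_top L
  using L_lattice
  by unfold_locales (auto simp: n_lattice_def n_poset_def)

text \<open>Closed form of the order of the extension. It does not mention a stage: on the elements
  present at each stage up to \<open>m\<close>, the order is the restriction of this one
  relation.\<close>

definition ext_le :: "nat \<Rightarrow> nat \<Rightarrow> bool" where
  "ext_le x y \<longleftrightarrow> x = y \<or> x = 0 \<or> (x < n \<and> y < n \<and> x \<sqsubseteq>\<^bsub>L\<^esub> y) \<or> (n \<le> x \<and> y \<in> up L (A x))"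

lemma up_less: "y \<in> up L B \<Longrightarrow> y < n"
  by (simp add: up_def carrier_L)

lemma subset_up: "B \<subseteq> carrier L \<Longrightarrow> B \<subseteq> up L B"
  unfolding up_def using L.le_refl by blast

lemma up_closed:
  assumes "x \<in> up L B" "B \<subseteq> carrier L" "y < n" "x \<sqsubseteq>\<^bsub>L\<^esub> y"
  shows "y \<in> up L B"
proof -
  from assms obtain a where a: "a \<in> B" "a \<sqsubseteq>\<^bsub>L\<^esub> x" "x \<in> carrier L" by (auto simp: up_def)
  then have "a \<sqsubseteq>\<^bsub>L\<^esub> y" using assms by (intro L.le_trans[of a x y]) (auto simp: carrier_L)
  then show ?thesis using a assms(3) by (auto simp: up_def carrier_L)
qed

lemma zero_notin_up: "n \<le> i \<Longrightarrow> i < n + m \<Longrightarrow> 0 \<notin> up L (A i)"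
  using A_subset[of i] le_zero by (auto simp: up_def carrier_L)

lemma ext_le_old: "x < n \<Longrightarrow> y < n \<Longrightarrow> ext_le x y \<longleftrightarrow> x \<sqsubseteq>\<^bsub>L\<^esub> y"
  using zero_le by (auto simp: ext_le_def carrier_L)

lemma ext_le_new: "n \<le> x \<Longrightarrow> ext_le x y \<longleftrightarrow> x = y \<or> y \<in> up L (A x)"
  using n_ge_2 by (auto simp: ext_le_def)

lemma ext_le_to_new: "n \<le> y \<Longrightarrow> ext_le x y \<longleftrightarrow> x = y \<or> x = 0"
  using up_less[of y "A x"] by (auto simp: ext_le_def)

text \<open>If a new element is involved, a cycle would have to pass through 0 and a new element,
  but 0 is not in any \<open>up L (A i)\<close>.\<close>

lemma ext_le_antisym:
  assumes "ext_le x y" "ext_le y x" "x < n + m" "y < n + m"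
  shows "x = y"
proof (cases "x < n \<and> y < n")
  case True
  then show ?thesis using assms by (simp add: ext_le_old L.le_antisym carrier_L)
next
  case False
  then show ?thesis
    using assms n_ge_2 zero_notin_up by (auto simp: not_less ext_le_new ext_le_to_new)
qed

lemma ext_le_trans:
  assumes "ext_le x y" "ext_le y z" "x < n + m" "y < n + m"
  shows "ext_le x z"
proof -
  consider "x = y \<or> x = 0" | "y = z" | "y = 0" | "x \<noteq> 0" "x \<noteq> y" "y \<noteq> 0" "y \<noteq> z" by blast
  then show ?thesis
  proof cases
    case 3
    then show ?thesis
      using assms zero_notin_up[of x] le_zero[of x] n_ge_2 by (auto simp: ext_le_def)
  next
    case 4
    \<comment> \<open>A nonzero element strictly above a nonzero element is old, and so is
      everything above it. The claim thus reduces to transitivity in \<open>L\<close> or to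
      up-closedness of \<open>up L (A x)\<close>.\<close>
    then have y: "y < n" using assms(1) up_less by (auto simp: ext_le_def)
    with 4 assms(2) have yz: "z < n" "y \<sqsubseteq>\<^bsub>L\<^esub> z" by (auto simp: ext_le_def)
    show ?thesis
    proof (cases "x < n")
      case True
      then have "x \<sqsubseteq>\<^bsub>L\<^esub> y" using assms(1) y by (simp add: ext_le_old)
      then have "x \<sqsubseteq>\<^bsub>L\<^esub> z" using True y yz by (auto intro: L.le_trans simp: carrier_L)
      then show ?thesis using True yz by (simp add: ext_le_old)
    next
      case False
      then have "y \<in> up L (A x)" using assms(1) 4 by (simp add: ext_le_new)
      then have "z \<in> up L (A x)" using A_subset[of x] False assms(3) yz by (auto intro: up_closed)
      then show ?thesis using False by (simp add: ext_le_new)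
    qed
  qed (use assms in \<open>auto simp: ext_le_def\<close>)
qed

section \<open>Identification of the iterated closure with the closed form\<close>

lemma extend_seq_carrier: "carrier (extend_seq n L A j) = {0..<n + j}"
  by (cases j) (auto simp: extend_def carrier_L)

lemma extend_seq_eq: "(.=\<^bsub>extend_seq n L A j\<^esub>) = (=)"
  by (cases j) (auto simp: extend_def L.eq_is_equal)

text \<open>By induction on the stage. The generating relation \<open>T\<close> of the last closure
  is contained in the transitive relation \<open>ext_le\<close>, and conversely every instance of
  \<open>ext_le\<close> is reached by at most two \<open>T\<close>-steps.\<close>

lemma extend_seq_le:
  assumes "j \<le> m" "x < n + j" "y < n + j"
  shows "x \<sqsubseteq>\<^bsub>extend_seq n L A j\<^esub> y \<longleftrightarrow> ext_le x y"
  using assms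
proof (induction j arbitrary: x y)
  case 0
  then show ?case by (simp add: ext_le_old)
next
  case (Suc j)
  define T where "T = (\<lambda>x y. (x < n + j \<and> y < n + j \<and> ext_le x y)
    \<or> (x = 0 \<and> y = n + j) \<or> (x = n + j \<and> y \<in> A (n + j)))"
  have "le (extend_seq n L A (Suc j)) = (\<lambda>x y. (x \<in> carrier (extend_seq n L A j) \<and>
      y \<in> carrier (extend_seq n L A j) \<and> x \<sqsubseteq>\<^bsub>extend_seq n L A j\<^esub> y)
      \<or> (x = 0 \<and> y = n + j) \<or> (x = n + j \<and> y \<in> A (n + j)))\<^sup>*\<^sup>*"
    by (simp add: extend_def)
  also have "\<dots> = T\<^sup>*\<^sup>*"
    using Suc.IH Suc.prems(1)
    by (intro arg_cong[where f = rtranclp] ext) (auto simp: T_def extend_seq_carrier)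
  finally have le: "le (extend_seq n L A (Suc j)) = T\<^sup>*\<^sup>*" .
  have A_up: "A (n + j) \<subseteq> up L (A (n + j))" "A (n + j) \<subseteq> carrier L"
    using A_subset[of "n + j"] subset_up[of "A (n + j)"] Suc.prems(1) by auto
  have T_ext: "ext_le x y \<and> x < n + m \<and> y < n + m" if "T x y" for x y
    using that A_up Suc.prems(1) n_ge_2 by (auto simp: T_def ext_le_def carrier_L)
  have "ext_le x y" if "T\<^sup>*\<^sup>* x y" "x < n + m" for x y
    using that(1)
  proof (induction rule: rtranclp_induct)
    case base
    then show ?case by (simp add: ext_le_def)
  next
    case (step y z)
    then show ?case using T_ext[of y z] ext_le_trans[of x y z] that(2) by blast
  qed
  moreover have "T\<^sup>*\<^sup>* x y" if xy: "ext_le x y" "x < n + Suc j" "y < n + Suc j" for x y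
  proof -
    have "x < n + j \<or> x = n + j" "y < n + j \<or> y = n + j" using that by auto
    then consider "x = y" | "x \<noteq> y" "x < n + j" "y < n + j"
      | "x \<noteq> y" "y = n + j" | "x \<noteq> y" "x = n + j" by blast
    then show ?thesis
    proof cases
      case 3
      then show ?thesis using that by (auto simp: ext_le_to_new T_def)
    next
      case 4
      then have y: "y \<in> up L (A (n + j))" using xy by (simp add: ext_le_new)
      then obtain a where a: "a \<in> A (n + j)" "a \<sqsubseteq>\<^bsub>L\<^esub> y" by (auto simp: up_def)
      have "y < n" using up_less[OF y] .
      \<comment> \<open>From the newest element the path goes through a generator \<open>a\<close>
        in \<open>A (n + j)\<close> and continues inside \<open>L\<close>.\<close>
      then have "T (n + j) a" "T a y"
        using a A_up by (auto simp: T_def ext_le_old carrier_L)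
      then show ?thesis using 4 by auto
    qed (use that in \<open>auto simp: T_def\<close>)
  qed
  ultimately show ?case using Suc.prems le by auto
qed

abbreviation M :: "nat gorder" where
  "M \<equiv> extend_seq n L A m"

lemmas carrier_M = extend_seq_carrier[of m]
lemmas le_M = extend_seq_le[OF order_refl]

sublocale M: partial_order M
proof
  show "x \<sqsubseteq>\<^bsub>M\<^esub> z"
    if "x \<sqsubseteq>\<^bsub>M\<^esub> y" "y \<sqsubseteq>\<^bsub>M\<^esub> z" "x \<in> carrier M" "y \<in> carrier M" "z \<in> carrier M"
    for x y z using that ext_le_trans by (auto simp: carrier_M le_M)
qed (auto simp: extend_seq_eq carrier_M le_M ext_le_antisym, auto simp: ext_le_def)

text \<open>Non-emptiness matters: if \<open>A i\<close> were empty, the new element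
  \<open>i\<close> would lie below no old element, in particular not below 1.\<close>

lemma finite_order_top_M:
  assumes "\<And>i. n \<le> i \<Longrightarrow> i < n + m \<Longrightarrow> A i \<noteq> {}"
  shows "finite_order_top M"
proof
  have "ext_le x 1" if x: "x < n + m" for x
  proof (cases "x < n")
    case True
    then show ?thesis using n_ge_2 le_one by (simp add: ext_le_old)
  next
    case False
    then obtain a where "a \<in> A x" using x assms[of x] False by auto
    moreover from this have "a < n" using x False A_subset[of x] by (auto simp: carrier_L)
    ultimately have "1 \<in> up L (A x)"
      using n_ge_2 le_one[of a] by (auto simp: up_def carrier_L)
    then show ?thesis using False by (simp add: ext_le_new)
  qed
  then show "greatest M 1 (carrier M)"
    using n_ge_2 by (auto simp: greatest_def carrier_M le_M)
qed (simp add: carrier_M)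

lemma n_poset_M:
  assumes "\<And>i. n \<le> i \<Longrightarrow> i < n + m \<Longrightarrow> A i \<noteq> {}"
  shows "n_poset (n + m) M"
  using finite_order_top.top[OF finite_order_top_M[OF assms]] n_ge_2 M.partial_order_axioms
  by (auto simp: n_poset_def carrier_M least_def le_M ext_le_def)

text \<open>Everything above a nonzero old element is old, and the two orders agree on old elements,
  so both posets have the same chains from \<open>a\<close> to 1.\<close>

lemma dep_M_old:
  assumes "1 \<le> a" "a < n"
  shows "dep M a = dep L a"
proof -
  have "C \<subseteq> {0..<n}" if "C \<in> chains_to_top M a" for C
    using that assms up_less
    by (force simp: chains_to_top_def least_def carrier_M le_M ext_le_def)
  moreover have "C \<subseteq> {0..<n} \<Longrightarrow> C \<in> chains_to_top M a \<longleftrightarrow> C \<in> chains_to_top L a" for C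
  proof -
    assume C: "C \<subseteq> {0..<n}"
    then have le: "x \<sqsubseteq>\<^bsub>M\<^esub> y \<longleftrightarrow> x \<sqsubseteq>\<^bsub>L\<^esub> y" if "x \<in> C" "y \<in> C" for x y
    proof -
      have "x < n" "y < n" using that C by auto
      then show ?thesis by (simp add: le_M ext_le_old)
    qed
    have sub: "C \<subseteq> carrier M" "C \<subseteq> carrier L"
      using C by (auto simp: carrier_M carrier_L)
    show ?thesis
      using le sub
      by (auto simp: chains_to_top_def Complete_Partial_Order.chain_def least_def greatest_def)
  qed
  moreover have "C \<subseteq> {0..<n}" if "C \<in> chains_to_top L a" for C
    using that by (simp add: chains_to_top_def carrier_L)
  ultimately have "chains_to_top M a = chains_to_top L a" by blast
  then show ?thesis by (simp add: dep_def)
qed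

section \<open>Meets and depths in the extension\<close>

text \<open>The meet in \<open>L\<close> remains a common lower bound in \<open>M\<close>, hence
  lies below the atom \<open>i\<close>. Only 0 and \<open>i\<close> do, and the meet is old.\<close>

lemma meet_old_eq_0_if_greatest_new:
  assumes i: "n \<le> i" "i < n + m" and ab: "a < n" "b < n"
    and g: "greatest M i (Lower M {a, b})"
  shows "a \<sqinter>\<^bsub>L\<^esub> b = 0"
proof -
  have mem: "a \<sqinter>\<^bsub>L\<^esub> b < n"
    using ab L.meet_closed[of a b] by (simp add: carrier_L)
  have "a \<sqinter>\<^bsub>L\<^esub> b \<in> Lower M {a, b}"
    using ab mem
    by (auto intro!: Lower_memI
        simp: carrier_M le_M ext_le_old L.meet_left L.meet_right carrier_L)
  then have "a \<sqinter>\<^bsub>L\<^esub> b \<sqsubseteq>\<^bsub>M\<^esub> i" using g by (simp add: greatest_def)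
  then show ?thesis using i mem by (simp add: le_M ext_le_to_new)
qed

lemma greatest_old_eq_meet:
  assumes "c < n" "a < n" "b < n"
    and g: "greatest M c (Lower M {a, b})"
  shows "c = a \<sqinter>\<^bsub>L\<^esub> b"
proof -
  have mem: "a \<sqinter>\<^bsub>L\<^esub> b < n"
    using assms L.meet_closed[of a b] by (simp add: carrier_L)
  have "a \<sqinter>\<^bsub>L\<^esub> b \<in> Lower M {a, b}"
    using assms mem
    by (auto intro!: Lower_memI
        simp: carrier_M le_M ext_le_old L.meet_left L.meet_right carrier_L)
  then have "a \<sqinter>\<^bsub>L\<^esub> b \<sqsubseteq>\<^bsub>L\<^esub> c"
    using g assms mem by (auto simp: greatest_def le_M ext_le_old)
  moreover have "c \<sqsubseteq>\<^bsub>L\<^esub> a" "c \<sqsubseteq>\<^bsub>L\<^esub> b"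
    using g assms by (auto simp: greatest_def Lower_def carrier_M le_M ext_le_old)
  ultimately show ?thesis
    using assms mem by (intro L.le_antisym L.meet_le) (auto simp: carrier_L)
qed

lemma above_new_if_greatest:
  assumes i: "n \<le> i" "i < n + m" and ab: "a \<in> up L (A i)" "b \<in> up L (A i)"
    and g: "greatest M c (Lower M {a, b})"
  shows "c = i \<or> c \<in> up L (A i)"
proof -
  have "i \<in> Lower M {a, b}"
    using i ab up_less by (auto intro!: Lower_memI simp: carrier_M le_M ext_le_new trans_less_add1)
  then have "i \<sqsubseteq>\<^bsub>M\<^esub> c" "c < n + m"
    using g by (auto simp: greatest_def Lower_def carrier_M)
  then show ?thesis using i by (auto simp: le_M ext_le_new)
qed

section \<open>From a lattice extension to the conditions on the sets \<open>A i\<close>\<close>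

lemma obtain_greatest:
  assumes "lattice M" "a < n" "b < n"
  obtains c where "greatest M c (Lower M {a, b})"
proof -
  interpret M: lattice M by fact
  show ?thesis using that M.inf_of_two_exists[of a b] assms by (auto simp: carrier_M)
qed

text \<open>The meet \<open>c\<close> in \<open>M\<close> lies above \<open>i\<close>. If
  \<open>c = i\<close>, the meet in \<open>L\<close> is 0; otherwise \<open>c\<close> is old, so it
  is the meet in \<open>L\<close> and belongs to \<open>up L (A i)\<close>.\<close>

lemma meet_in_up_if_lattice_M:
  assumes M: "lattice M" and i: "n \<le> i" "i < n + m"
    and ab: "a \<in> up L (A i)" "b \<in> up L (A i)"
  shows "a \<sqinter>\<^bsub>L\<^esub> b \<in> {0} \<union> up L (A i)"
proof -
  have less: "a < n" "b < n" using ab up_less by auto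
  obtain c where g: "greatest M c (Lower M {a, b})" using obtain_greatest[OF M less] .
  show ?thesis
    using above_new_if_greatest[OF i ab g]
      meet_old_eq_0_if_greatest_new[of i a b] greatest_old_eq_meet[of c a b] g i less up_less
    by auto
qed

text \<open>The meet \<open>c\<close> in \<open>M\<close> lies above the two distinct atoms
  \<open>i\<close> and \<open>j\<close>. Hence it is neither of them, but an old nonzero element,
  which must be the meet in \<open>L\<close>.\<close>

lemma meet_ne_0_if_lattice_M:
  assumes M: "lattice M" and ij: "n \<le> i" "i < j" "j < n + m"
    and a: "a \<in> up L (A i) \<inter> up L (A j)" and b: "b \<in> up L (A i) \<inter> up L (A j)"
  shows "a \<sqinter>\<^bsub>L\<^esub> b \<noteq> 0"
proof -
  have less: "a < n" "b < n" using a b up_less by auto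
  obtain c where g: "greatest M c (Lower M {a, b})" using obtain_greatest[OF M less] .
  have "c = i \<or> c \<in> up L (A i)" "c = j \<or> c \<in> up L (A j)"
    using above_new_if_greatest[OF _ _ _ _ g] a b ij by auto
  then have "c \<in> up L (A i)"
    using ij up_less[of c] by fastforce
  then show ?thesis
    using greatest_old_eq_meet[OF _ less g] up_less zero_notin_up[of i] ij by fastforce
qed

text \<open>For old elements the meet in \<open>L\<close> stays the meet, unless it is 0 and some
  new atom lies below both; then that atom is the meet.\<close>

lemma lower_semilattice_M:
  assumes la: "\<And>i. n \<le> i \<Longrightarrow> i < n + m \<Longrightarrow> lattice_antichain L (A i)"
    and ne0: "\<And>i j a b. n \<le> i \<Longrightarrow> i < j \<Longrightarrow> j < n + m \<Longrightarrow> a \<in> up L (A i) \<inter> up L (A j) \<Longrightarrow>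
      b \<in> up L (A i) \<inter> up L (A j) \<Longrightarrow> a \<sqinter>\<^bsub>L\<^esub> b \<noteq> 0"
  shows "lower_semilattice M"
proof
  fix x y
  assume "x \<in> carrier M" "y \<in> carrier M"
  then have xy: "x < n + m" "y < n + m" by (auto simp: carrier_M)
  have glb: "\<exists>s. greatest M s (Lower M {x, y})"
    if "s < n + m" "ext_le s x" "ext_le s y"
      "\<And>z. z < n + m \<Longrightarrow> ext_le z x \<Longrightarrow> ext_le z y \<Longrightarrow> ext_le z s" for s
    using that xy by (intro exI[of _ s]) (auto simp: greatest_def Lower_def carrier_M le_M)
  have ext0: "ext_le 0 z" for z by (simp add: ext_le_def)
  consider "ext_le x y" | "ext_le y x" | "\<not> ext_le x y" "\<not> ext_le y x" "n \<le> x \<or> n \<le> y"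
    | "x < n" "y < n" by linarith
  then show "\<exists>s. greatest M s (Lower M {x, y})"
  proof cases
    case 1
    then show ?thesis using xy by (intro glb[of x]) (auto simp: ext_le_def)
  next
    case 2
    then show ?thesis using xy by (intro glb[of y]) (auto simp: ext_le_def)
  next
    case 3
    \<comment> \<open>Below a new element there are only itself and 0, so incomparability leaves 0
      as the sole common lower bound.\<close>
    then show ?thesis using xy ext0 ext_le_to_new by (intro glb[of 0]) auto
  next
    case 4
    let ?c = "x \<sqinter>\<^bsub>L\<^esub> y"
    have c: "?c < n" "?c \<sqsubseteq>\<^bsub>L\<^esub> x" "?c \<sqsubseteq>\<^bsub>L\<^esub> y"
      using 4 L.meet_closed[of x y] by (auto simp: carrier_L L.meet_left L.meet_right)
    have old: "ext_le z ?c" if "z < n" "ext_le z x" "ext_le z y" for z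
      using that 4 c L.meet_le[of z x y] by (auto simp: ext_le_old carrier_L)
    \<comment> \<open>Here the lattice-antichain condition enters: a new common lower bound can fail
      to lie below the old meet only if that meet is 0.\<close>
    have new: "ext_le z ?c \<or> ?c = 0 \<and> x \<in> up L (A z) \<and> y \<in> up L (A z)"
      if "n \<le> z" "z < n + m" "ext_le z x" "ext_le z y" for z
    proof -
      have "x \<in> up L (A z)" "y \<in> up L (A z)" using that 4 by (auto simp: ext_le_new)
      moreover from this have "?c \<in> {0} \<union> up L (A z)"
        using la[OF that(1,2)] unfolding lattice_antichain_def by blast
      ultimately show ?thesis using that(1) by (auto simp: ext_le_new)
    qed
    show ?thesis
    proof (cases "\<exists>i. n \<le> i \<and> i < n + m \<and> ?c = 0 \<and> x \<in> up L (A i) \<and> y \<in> up L (A i)")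
      case True
      then obtain i where i: "n \<le> i" "i < n + m" "?c = 0" "x \<in> up L (A i)" "y \<in> up L (A i)"
        by blast
      show ?thesis
      proof (rule glb[of i])
        fix z assume z: "z < n + m" "ext_le z x" "ext_le z y"
        show "ext_le z i"
        proof (cases "z < n")
          case True
          then have "z = 0" using old[of z] z i le_zero[of z] c(1) by (simp add: ext_le_old)
          then show ?thesis by (simp add: ext0)
        next
          case False
          then have "x \<in> up L (A z)" "y \<in> up L (A z)" using z 4 by (auto simp: ext_le_new)
          \<comment> \<open>Two distinct new atoms below both \<open>x\<close> and \<open>y\<close>
            would force a nonzero meet. Both instances of \<open>ne0\<close> are supplied because it
            assumes the indices in increasing order.\<close>
          then have "z = i"
            using ne0[of i z x y] ne0[of z i x y] i z False by (metis IntI linorder_neqE_nat not_less)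
          then show ?thesis by (simp add: ext_le_def)
        qed
      qed (use i in \<open>auto simp: ext_le_new\<close>)
    next
      case False
      show ?thesis
      proof (rule glb[of ?c])
        fix z assume "z < n + m" "ext_le z x" "ext_le z y"
        then show "ext_le z ?c" using old[of z] new[of z] False by (cases "z < n") auto
      qed (use c 4 in \<open>auto simp: ext_le_old\<close>)
    qed
  qed
qed

text \<open>By \<open>dep_step\<close>, the depth of \<open>i\<close> is one more than that of some
  old \<open>b\<close> above a member \<open>a\<close> of \<open>A i\<close>. If \<open>b\<close>
  has depth \<open>k\<close>, so has \<open>a\<close>, since depth is antitone and bounded by
  \<open>k\<close>. Conversely, a member of depth \<open>k\<close> makes \<open>i\<close> deeper
  than \<open>k\<close>, while the bound on \<open>b\<close> allows at most
  \<open>k + 1\<close>.\<close>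

lemma dep_M_new:
  assumes M: "finite_order_top M" and k: "\<And>a. 1 \<le> a \<Longrightarrow> a < n \<Longrightarrow> dep L a \<le> k"
    and i: "n \<le> i" "i < n + m"
  shows "dep M i = k + 1 \<longleftrightarrow> A i \<inter> lev k L \<noteq> {}"
proof
  interpret M: finite_order_top M by fact
  have A: "A i \<subseteq> {1..<n}" using A_subset[OF i] by (auto simp: carrier_L)
  have up: "1 \<le> b \<and> b < n" if "b \<in> up L (A i)" for b
    using that zero_notin_up[OF i] up_less[of b] by (cases b) auto
  obtain b where "b \<in> carrier M" "i \<sqsubseteq>\<^bsub>M\<^esub> b" "i \<noteq> b" and dep: "dep M i = Suc (dep M b)"
    using M.dep_step[of i] i n_ge_2 by (auto simp: carrier_M)
  then have b: "b \<in> up L (A i)" using i by (simp add: carrier_M le_M ext_le_new)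
  with up[OF b] dep have dep': "dep M i = Suc (dep L b)" by (simp add: dep_M_old)
  {
    assume "dep M i = k + 1"
    then have "dep L b = k" using dep' by simp
    from b obtain a where a: "a \<in> A i" "a \<sqsubseteq>\<^bsub>L\<^esub> b" "b \<in> carrier L" by (auto simp: up_def)
    then have "k \<le> dep L a"
      using L.dep_mono[of a b] A \<open>dep L b = k\<close> by (auto simp: carrier_L)
    then have "a \<in> lev k L" using k[of a] a A by (auto simp: lev_def carrier_L)
    then show "A i \<inter> lev k L \<noteq> {}" using a by blast
  }
  assume "A i \<inter> lev k L \<noteq> {}"
  then obtain a where a: "a \<in> A i" "dep L a = k" by (auto simp: lev_def)
  then have "a \<in> up L (A i)" using A_subset[OF i] subset_up[of "A i"] by blast
  then have "dep M a < dep M i"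
    using i up[of a] by (intro M.dep_less) (auto simp: carrier_M le_M ext_le_new)
  moreover have "dep M a = k" using a A by (auto simp: dep_M_old)
  ultimately show "dep M i = k + 1" using dep' k[of b] up[OF b] by simp
qed

end

theorem theorem3p12:
  fixes L :: "nat gorder" and n m k :: nat and A :: "nat \<Rightarrow> nat set"
  assumes "n_lattice n L"
    and "levellised n L"
    and "dep L (n - 1) = k"
    and "0 < m"
    and "\<And>i. n \<le> i \<Longrightarrow> i < n + m \<Longrightarrow> A i \<subseteq> carrier L - {0}"
    and "\<And>i. n \<le> i \<Longrightarrow> i < n + m \<Longrightarrow> antichain L (A i)"
  shows
    "(n_lattice (n + m) (extend_seq n L A m) \<and>
      levellised (n + m) (extend_seq n L A m) \<and>
      (\<forall>a. 1 \<le> a \<and> a < n \<longrightarrow> dep (extend_seq n L A m) a = dep L a \<and> dep L a \<le> k) \<and>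
      (\<forall>i. n \<le> i \<and> i < n + m \<longrightarrow> dep (extend_seq n L A m) i = k + 1))
     \<longleftrightarrow>
     ((\<forall>i. n \<le> i \<and> i < n + m \<longrightarrow> A i \<inter> lev k L \<noteq> {}) \<and>
      (\<forall>i. n \<le> i \<and> i < n + m \<longrightarrow> lattice_antichain L (A i)) \<and>
      (\<forall>i j. n \<le> i \<and> i < j \<and> j < n + m \<longrightarrow>
         (\<forall>a \<in> up L (A i) \<inter> up L (A j). \<forall>b \<in> up L (A i) \<inter> up L (A j). a \<sqinter>\<^bsub>L\<^esub> b \<noteq> 0)))"
    (is "?lhs \<longleftrightarrow> ?rhs")
proof -
  interpret lattice_extension L n m A using assms by unfold_locales
  have dep_le: "dep L a \<le> k" if "1 \<le> a" "a < n" for a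
    using assms(2,3) that by (auto simp: levellised_def)
  show ?thesis
  proof
    assume l: ?lhs
    then have M: "lattice M" "n_poset (n + m) M" by (auto simp: n_lattice_def)
    have top: "finite_order_top M"
      using M(2) by unfold_locales (auto simp: n_poset_def)
    \<comment> \<open>The depth condition comes first because it yields the non-emptiness required
      of a lattice-antichain. The antichain property is taken from the hypothesis: the order of
      \<open>M\<close> depends on \<open>A i\<close> only through its up-set.\<close>
    have lev: "A i \<inter> lev k L \<noteq> {}" if "n \<le> i" "i < n + m" for i
      using l dep_M_new[OF top dep_le that] that by blast
    then have "lattice_antichain L (A i)" if "n \<le> i" "i < n + m" for i
      using that assms(5,6)[OF that] meet_in_up_if_lattice_M[OF M(1) that]
      unfolding lattice_antichain_def by blast
    then show ?rhs using lev meet_ne_0_if_lattice_M[OF M(1)] by blast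
  next
    assume r: ?rhs
    then have ne: "A i \<noteq> {}" if "n \<le> i" "i < n + m" for i using that by blast
    note top = finite_order_top_M[OF ne]
    interpret N: lower_semilattice M
      using r by (intro lower_semilattice_M) blast+
    have "lattice M"
      using finite_order_top.fin[OF top] finite_order_top.top[OF top]
      by (rule N.finite_top_imp_lattice)
    then have "n_lattice (n + m) M" using n_poset_M[OF ne] by (simp add: n_lattice_def)
    moreover have new: "dep M i = k + 1" if "n \<le> i" "i < n + m" for i
      using r dep_M_new[OF top dep_le that] that by blast
    \<comment> \<open>Old elements keep their depths, which are at most \<open>k\<close>, and all
      new elements have depth \<open>k + 1\<close>.\<close>
    moreover have "levellised (n + m) M"
      unfolding levellised_def
    proof (intro allI impI, elim conjE)
      fix i j assume ij: "0 < i" "i \<le> j" "j < n + m"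
      show "dep M i \<le> dep M j"
      proof (cases "j < n")
        case True
        then show ?thesis using ij assms(2) by (simp add: dep_M_old levellised_def)
      next
        case False
        then show ?thesis using ij new[of i] new[of j] dep_M_old[of i] dep_le[of i]
          by (cases "i < n") auto
      qed
    qed
    ultimately show ?lhs using dep_M_old dep_le by blast
  qed
qed

end
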